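(* Let $0<\varepsilon\leq 1$ and let $\mathcal{W}=\{W_1,W_2,\dots\}$ be a $(1-\varepsilon)$-full separating system in which each $W_k$ is $(A_k,B_k)$-bipartite. Then $$\sum_{k=1}^{|\mathcal{W}|} m(A_k\cup B_k)\geq \log\frac{1}{\varepsilon}.$$
   Context: All logarithms are to base $2$ and $m$ denotes Lebesgue measure. A graphon is a symmetric measurable function $W:[0,1]^2\to[0,1]$. For measurable $A,B\subseteq[0,1]$, a graphon $W$ is $(A,B)$-bipartite if $m(A\cap B)=0$ and $m\big(\mathrm{supp}(W)\setminus((A\times B)\cup(B\times A))\big)=0$; $W$ is bipartite if it is $(A,B)$-bipartite for some such $A,B$. A separating system is a countable (finite or infinite) collection $\mathcal{W}$ of bipartite graphons, identified with a sequence $W_1,W_2,\dots$. Define $\mathcal{W}^{\Sigma}(x,y)=\min\{1,\sum_{W\in\mathcal{W}}W(x,y)\}$; $\mathcal{W}$ is $\eta$-full if $\int_{[0,1]^2}\mathcal{W}^{\Sigma}(x,y)\,dx\,dy\geq\eta$. If the sum diverges, its value is $\infty$. *)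

theory Defs
  imports "HOL-Analysis.Analysis" "HOL-Library.Extended_Nat"
begin

abbreviation unit_square :: "(real \<times> real) set" where
  "unit_square \<equiv> {0..1} \<times> {0..1}"

text \<open>A graphon is a function on the unit square; the values of the HOL function elsewhere are
  unconstrained, and every definition below ignores them.\<close>

definition graphon :: "(real \<times> real \<Rightarrow> real) \<Rightarrow> bool" where
  "graphon W \<longleftrightarrow>
     W \<in> borel_measurable (lebesgue_on unit_square) \<and>
     (\<forall>p\<in>unit_square. W p \<in> {0..1}) \<and>
     (\<forall>x\<in>{0..1}. \<forall>y\<in>{0..1}. W (x, y) = W (y, x))"

definition graphon_support :: "(real \<times> real \<Rightarrow> real) \<Rightarrow> (real \<times> real) set" where
  "graphon_support W = {p \<in> unit_square. W p \<noteq> 0}"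

definition bipartite_wrt :: "(real \<times> real \<Rightarrow> real) \<Rightarrow> real set \<Rightarrow> real set \<Rightarrow> bool" where
  "bipartite_wrt W A B \<longleftrightarrow>
     A \<in> sets lebesgue \<and> A \<subseteq> {0..1} \<and>
     B \<in> sets lebesgue \<and> B \<subseteq> {0..1} \<and>
     A \<inter> B \<in> null_sets lebesgue \<and>
     graphon_support W - (A \<times> B \<union> B \<times> A) \<in> null_sets lebesgue"

definition bipartite :: "(real \<times> real \<Rightarrow> real) \<Rightarrow> bool" where
  "bipartite W \<longleftrightarrow> (\<exists>A B. bipartite_wrt W A B)"

text \<open>A countable collection of size \<open>N\<close>, finite or infinite, is a sequence
  \<open>W 1, W 2, \<dots>\<close> of which only the entries with index in \<open>indices N\<close> are used.\<close>

definition indices :: "enat \<Rightarrow> nat set" where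
  "indices N = {k. 1 \<le> k \<and> enat k \<le> N}"

definition separating_system :: "enat \<Rightarrow> (nat \<Rightarrow> real \<times> real \<Rightarrow> real) \<Rightarrow> bool" where
  "separating_system N W \<longleftrightarrow> (\<forall>k\<in>indices N. graphon (W k) \<and> bipartite (W k))"

text \<open>The sum is taken in \<^typ>\<open>ennreal\<close>, where it is \<open>\<infinity>\<close> in case of divergence.\<close>

definition system_sum :: "enat \<Rightarrow> (nat \<Rightarrow> real \<times> real \<Rightarrow> real) \<Rightarrow> real \<times> real \<Rightarrow> ennreal" where
  "system_sum N W p = min 1 (\<Sum>\<^sub>\<infinity>k\<in>indices N. ennreal (W k p))"

definition full :: "real \<Rightarrow> enat \<Rightarrow> (nat \<Rightarrow> real \<times> real \<Rightarrow> real) \<Rightarrow> bool" where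
  "full \<eta> N W \<longleftrightarrow> (\<integral>\<^sup>+p\<in>unit_square. system_sum N W p \<partial>lebesgue) \<ge> ennreal \<eta>"

end

theory Submission
  imports Defs "HOL-Probability.Probability_Measure"
begin

text \<open>Off the union of the sets \<open>A\<^sub>k \<times> B\<^sub>k \<union> B\<^sub>k \<times> A\<^sub>k\<close> the function \<open>\<W>\<^sup>\<Sigma>\<close> vanishes almost
  everywhere, so the set \<open>C\<close> of pairs separated by no \<open>k\<close> has measure at most \<open>\<epsilon>\<close>.
  Let \<open>d(x)\<close> be the number of \<open>k\<close> with \<open>x \<in> A\<^sub>k \<union> B\<^sub>k\<close>, for finitely many \<open>k\<close>. Choosing for each
  \<open>k\<close> at random which of \<open>A\<^sub>k\<close>, \<open>B\<^sub>k\<close> to delete leaves a random set \<open>R\<close> with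
  \<open>P(x \<in> R) = 2\<^bsup>-d(x)\<^esup>\<close> and \<open>P(x, y \<in> R) 2\<^bsup>(d(x)+d(y))/2\<^esup> \<le> 1\<^sub>C(x, y)\<close>. Integrating and using
  Cauchy--Schwarz, \<open>m(C) \<ge> (\<integral> 2\<^bsup>-d/2\<^esup>)\<^sup>2\<close>, which is at least \<open>2\<^bsup>-\<integral>d\<^esup>\<close> by Jensen's inequality.
  The random choice is unrolled into an induction over the pairs \<open>(A\<^sub>k, B\<^sub>k)\<close>.
  The infinite case follows by continuity of measure.\<close>

section \<open>The weighted kernel inequality for disjoint pairs\<close>

definition bipartite_edges :: "'a set \<Rightarrow> 'a set \<Rightarrow> ('a \<times> 'a) set" where
  "bipartite_edges A B = A \<times> B \<union> B \<times> A"

lemma sets_bipartite_edges [measurable]: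
  assumes [measurable]: "A \<in> sets M" "B \<in> sets M"
  shows "bipartite_edges A B \<in> sets (M \<Otimes>\<^sub>M M)"
  unfolding bipartite_edges_def by measurable

lemma ennreal_inverse_sqrt2_square:
  "ennreal (1 / sqrt 2) * ennreal (1 / sqrt 2) + ennreal (1 / sqrt 2) * ennreal (1 / sqrt 2) = 1"
proof -
  have "ennreal (1 / sqrt 2) * ennreal (1 / sqrt 2) = ennreal (1 / 2)"
    by (subst ennreal_mult[symmetric]) auto
  then show ?thesis
    by (simp only:) (subst ennreal_plus[symmetric], auto)
qed

text \<open>Two-term Cauchy--Schwarz, from 2pq <= p^2 + q^2. Applied once per pair in the induction,
  it replaces Cauchy--Schwarz over all random deletions at once.\<close>

lemma ennreal_mult_add_sqrt2_square_le:
  fixes a b :: ennreal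
  shows "(ennreal (1 / sqrt 2) * (a + b))\<^sup>2 \<le> a\<^sup>2 + b\<^sup>2"
proof (cases "a = top \<or> b = top")
  case True
  then show ?thesis by (auto simp: power2_eq_square)
next
  case False
  then obtain p q where pq: "a = ennreal p" "0 \<le> p" "b = ennreal q" "0 \<le> q"
    by (metis ennreal_cases)
  have "(1 / sqrt 2 * (p + q))\<^sup>2 \<le> p\<^sup>2 + q\<^sup>2"
    using sum_squares_bound[of p q] by (simp add: power_mult_distrib power_divide power2_sum)
  then have "ennreal ((1 / sqrt 2 * (p + q))\<^sup>2) \<le> ennreal (p\<^sup>2 + q\<^sup>2)"
    by (rule ennreal_leI)
  also have "ennreal ((1 / sqrt 2 * (p + q))\<^sup>2) = (ennreal (1 / sqrt 2) * (a + b))\<^sup>2"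
    using pq by (subst ennreal_power[symmetric], simp, subst ennreal_mult) auto
  finally show ?thesis
    using pq by (simp add: ennreal_power)
qed

text \<open>\<open>u A B\<close> encodes deleting \<open>B\<close>, and \<open>u B A\<close>
  deleting \<open>A\<close>: a surviving point gets weight sqrt 2 if covered by the pair and 1
  otherwise, scaled by 1 / sqrt 2, the root of the probability of the choice. On an edge each
  product has a zero factor. Otherwise the sum is 1 + 0 for two points on the same side, 1 / sqrt 2
  for one covered point, and 1/2 + 1/2 for none.\<close>

lemma sqrt2_kernel_le_indicator_nonedges:
  fixes A B :: "'a set"
  defines "u \<equiv> \<lambda>A B x. if x \<in> A then 1 else if x \<in> B then 0 else ennreal (1 / sqrt 2)"
  assumes "A \<inter> B = {}"
  shows "u A B x * u A B y + u B A x * u B A y \<le> indicator (- bipartite_edges A B) (x, y)"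
proof -
  have s: "ennreal (1 / sqrt 2) \<le> 1"
    by (simp add: ennreal_le_1)
  show ?thesis
    using assms s ennreal_inverse_sqrt2_square unfolding u_def bipartite_edges_def
    by (auto simp: indicator_def)
qed

text \<open>The weight \<open>w\<close> makes the induction over \<open>I\<close> work: a new pair \<open>(A, B)\<close>
  multiplies the kernel by a function dominating \<open>u(x) u(y) + v(x) v(y)\<close>, and
  the induction hypothesis is applied with the weights \<open>w u\<close> and \<open>w v\<close>.\<close>

lemma (in sigma_finite_measure) square_nn_integral_le_nonedges:
  fixes A B :: "'i \<Rightarrow> 'a set" and w :: "'a \<Rightarrow> ennreal"
  assumes "finite I"
    and AB: "\<And>k. k \<in> I \<Longrightarrow> A k \<in> sets M" "\<And>k. k \<in> I \<Longrightarrow> B k \<in> sets M"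
      "\<And>k. k \<in> I \<Longrightarrow> A k \<inter> B k = {}"
    and w: "w \<in> borel_measurable M"
  shows "(\<integral>\<^sup>+x. w x * (\<Prod>k\<in>I. if x \<in> A k \<union> B k then ennreal (1 / sqrt 2) else 1) \<partial>M)\<^sup>2
    \<le> (\<integral>\<^sup>+x. \<integral>\<^sup>+y. w x * w y * (\<Prod>k\<in>I. indicator (- bipartite_edges (A k) (B k)) (x, y)) \<partial>M \<partial>M)"
  using assms
proof (induction I arbitrary: w rule: finite_induct)
  case empty
  then have [measurable]: "w \<in> borel_measurable M" by simp
  show ?case
    by (simp add: nn_integral_cmult nn_integral_multc power2_eq_square)
next
  case (insert i I)
  let ?s = "ennreal (1 / sqrt 2)"
  define g where "g x = (\<Prod>k\<in>I. if x \<in> A k \<union> B k then ?s else 1)" for x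
  define C where "C p = (\<Prod>k\<in>I. indicator (- bipartite_edges (A k) (B k)) p :: ennreal)" for p
  define u where "u x = (if x \<in> A i then 1 else if x \<in> B i then 0 else ?s)" for x
  define v where "v x = (if x \<in> B i then 1 else if x \<in> A i then 0 else ?s)" for x
  have [measurable]: "w \<in> borel_measurable M" "A i \<in> sets M" "B i \<in> sets M"
    using insert.prems by auto
  have [measurable]: "u \<in> borel_measurable M" "v \<in> borel_measurable M"
    unfolding u_def v_def by measurable
  have [measurable]: "g \<in> borel_measurable M"
    unfolding g_def
  proof (rule borel_measurable_prod_ennreal)
    fix k assume "k \<in> I"
    then have [measurable]: "A k \<in> sets M" "B k \<in> sets M" using insert.prems by auto
    show "(\<lambda>x. if x \<in> A k \<union> B k then ?s else 1) \<in> borel_measurable M" by measurable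
  qed
  have [measurable]: "C \<in> borel_measurable (M \<Otimes>\<^sub>M M)"
    unfolding C_def
  proof (rule borel_measurable_prod_ennreal)
    fix k assume "k \<in> I"
    then have [measurable]: "bipartite_edges (A k) (B k) \<in> sets (M \<Otimes>\<^sub>M M)"
      using insert.prems by (auto intro: sets_bipartite_edges)
    \<comment> \<open>The complement is taken in the whole type and may leave the product space, so
      it need not be a measurable set; the conditional form avoids it.\<close>
    have "(\<lambda>p. if p \<in> bipartite_edges (A k) (B k) then 0 else 1::ennreal) \<in> borel_measurable (M \<Otimes>\<^sub>M M)"
      by measurable
    moreover have "indicator (- bipartite_edges (A k) (B k))
        = (\<lambda>p. if p \<in> bipartite_edges (A k) (B k) then 0 else 1::ennreal)"
      by (auto simp: indicator_def)
    ultimately show "(indicator (- bipartite_edges (A k) (B k)) :: _ \<Rightarrow> ennreal)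
        \<in> borel_measurable (M \<Otimes>\<^sub>M M)"
      by (simp only:)
  qed
  have IH: "(\<integral>\<^sup>+x. f x * g x \<partial>M)\<^sup>2 \<le> (\<integral>\<^sup>+x. \<integral>\<^sup>+y. f x * f y * C (x, y) \<partial>M \<partial>M)"
    if "f \<in> borel_measurable M" for f
    unfolding g_def C_def by (rule insert.IH) (use insert.prems that in auto)
  have disj: "A i \<inter> B i = {}" using insert.prems by auto
  \<comment> \<open>On either side of the pair one weight is 1 and the other 0; elsewhere both are 1
    / sqrt 2. So the factor of the new index splits into the two deletion choices.\<close>
  have uv: "?s * (u x + v x) = (if x \<in> A i \<union> B i then ?s else 1)" for x
    using disj ennreal_inverse_sqrt2_square by (auto simp: u_def v_def distrib_left)
  have "w x * (\<Prod>k\<in>insert i I. if x \<in> A k \<union> B k then ?s else 1)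
      = ?s * (w x * u x * g x + w x * v x * g x)" for x
  proof -
    have "(\<Prod>k\<in>insert i I. if x \<in> A k \<union> B k then ?s else 1) = ?s * (u x + v x) * g x"
      using insert.hyps unfolding uv g_def by simp
    then show ?thesis by (simp add: algebra_simps)
  qed
  then have "(\<integral>\<^sup>+x. w x * (\<Prod>k\<in>insert i I. if x \<in> A k \<union> B k then ?s else 1) \<partial>M)
      = (\<integral>\<^sup>+x. ?s * (w x * u x * g x + w x * v x * g x) \<partial>M)"
    by simp
  also have "\<dots> = ?s * ((\<integral>\<^sup>+x. w x * u x * g x \<partial>M) + (\<integral>\<^sup>+x. w x * v x * g x \<partial>M))"
    by (subst nn_integral_cmult) (auto simp: nn_integral_add)
  finally have "(\<integral>\<^sup>+x. w x * (\<Prod>k\<in>insert i I. if x \<in> A k \<union> B k then ?s else 1) \<partial>M)\<^sup>2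
      \<le> (\<integral>\<^sup>+x. w x * u x * g x \<partial>M)\<^sup>2 + (\<integral>\<^sup>+x. w x * v x * g x \<partial>M)\<^sup>2"
    using ennreal_mult_add_sqrt2_square_le by simp
  also have "\<dots> \<le> (\<integral>\<^sup>+x. \<integral>\<^sup>+y. (w x * u x) * (w y * u y) * C (x, y) \<partial>M \<partial>M)
      + (\<integral>\<^sup>+x. \<integral>\<^sup>+y. (w x * v x) * (w y * v y) * C (x, y) \<partial>M \<partial>M)"
    by (intro add_mono IH) auto
  also have "\<dots> = (\<integral>\<^sup>+x. \<integral>\<^sup>+y. (w x * u x) * (w y * u y) * C (x, y)
      + (w x * v x) * (w y * v y) * C (x, y) \<partial>M \<partial>M)"
    by (subst nn_integral_add[symmetric]) (auto intro!: nn_integral_cong nn_integral_add[symmetric])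
  also have "\<dots> \<le> (\<integral>\<^sup>+x. \<integral>\<^sup>+y. w x * w y *
      (\<Prod>k\<in>insert i I. indicator (- bipartite_edges (A k) (B k)) (x, y)) \<partial>M \<partial>M)"
  proof (intro nn_integral_mono)
    fix x y
    have "(w x * u x) * (w y * u y) * C (x, y) + (w x * v x) * (w y * v y) * C (x, y)
        = w x * w y * ((u x * u y + v x * v y) * C (x, y))"
      by (simp add: algebra_simps)
    also have "\<dots> \<le> w x * w y * (indicator (- bipartite_edges (A i) (B i)) (x, y) * C (x, y))"
      using sqrt2_kernel_le_indicator_nonedges[OF disj, of x y]
      by (intro mult_left_mono mult_right_mono) (auto simp: u_def v_def)
    finally show "(w x * u x) * (w y * u y) * C (x, y) + (w x * v x) * (w y * v y) * C (x, y)
      \<le> w x * w y * (\<Prod>k\<in>insert i I. indicator (- bipartite_edges (A k) (B k)) (x, y))"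
      using insert.hyps by (simp add: C_def)
  qed
  finally show ?case .
qed

section \<open>Jensen's inequality and the bound on a probability space\<close>

text \<open>Integrate the tangent line of \<open>exp\<close> at the mean of \<open>z\<close>: its
  linear term has expectation zero. An infinite right-hand side is allowed and makes the claim
  trivial.\<close>

lemma (in prob_space) exp_expectation_le_nn_integral_exp:
  fixes z :: "'a \<Rightarrow> real"
  assumes "integrable M z"
  shows "ennreal (exp (expectation z)) \<le> (\<integral>\<^sup>+x. ennreal (exp (z x)) \<partial>M)"
proof -
  let ?c = "expectation z"
  have [measurable]: "z \<in> borel_measurable M" using assms by auto
  have tangent: "exp ?c * (1 + (z x - ?c)) \<le> exp (z x)" for x
  proof -
    have "exp ?c * (1 + (z x - ?c)) \<le> exp ?c * exp (z x - ?c)"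
      by (intro mult_left_mono exp_ge_add_one_self) auto
    then show ?thesis by (simp flip: exp_add)
  qed
  show ?thesis
  proof (cases "(\<integral>\<^sup>+x. ennreal (exp (z x)) \<partial>M) = top")
    case False
    then have int: "integrable M (\<lambda>x. exp (z x))"
      by (intro integrableI_nonneg) (auto simp: less_top)
    have "exp ?c = expectation (\<lambda>x. exp ?c * (1 + (z x - ?c)))"
      using assms by (simp add: prob_space)
    also have "\<dots> \<le> expectation (\<lambda>x. exp (z x))"
      using assms int tangent by (intro integral_mono) auto
    finally show ?thesis
      using int by (subst nn_integral_eq_integral) auto
  qed auto
qed

lemma (in prob_space) powr_sum_prob_le_prob_nonedges:
  fixes A B :: "'i \<Rightarrow> 'a set"
  assumes "finite I"
    and AB: "\<And>k. k \<in> I \<Longrightarrow> A k \<in> sets M" "\<And>k. k \<in> I \<Longrightarrow> B k \<in> sets M"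
      "\<And>k. k \<in> I \<Longrightarrow> A k \<inter> B k = {}"
  shows "2 powr - (\<Sum>k\<in>I. prob (A k \<union> B k))
    \<le> 1 - measure (M \<Otimes>\<^sub>M M) (\<Union>k\<in>I. bipartite_edges (A k) (B k))"
proof -
  interpret P: pair_prob_space M M ..
  let ?s = "ennreal (1 / sqrt 2)"
  let ?E = "\<Union>k\<in>I. bipartite_edges (A k) (B k)"
  \<comment> \<open>\<open>exp (z x)\<close> is 2 to the power -d(x)/2, with d(x) the number of
    pairs covering \<open>x\<close>; the half disappears when Jensen's bound is squared.\<close>
  define z where "z x = (\<Sum>k\<in>I. - (ln 2 / 2) * indicator (A k \<union> B k) x :: real)" for x
  have E: "?E \<in> sets (M \<Otimes>\<^sub>M M)"
    using AB by (intro sets.finite_UN assms(1) sets_bipartite_edges) auto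
  have s: "exp (- (ln 2 / 2)) = 1 / sqrt (2::real)"
    by (simp add: exp_minus ln_sqrt[symmetric] inverse_eq_divide)
  have expz: "(\<Prod>k\<in>I. if x \<in> A k \<union> B k then ?s else 1) = ennreal (exp (z x))" for x
  proof -
    have "ennreal (exp (z x)) = (\<Prod>k\<in>I. ennreal (exp (- (ln 2 / 2) * indicator (A k \<union> B k) x)))"
      unfolding z_def exp_sum[OF assms(1)] by (simp add: prod_ennreal)
    also have "\<dots> = (\<Prod>k\<in>I. if x \<in> A k \<union> B k then ?s else 1)"
      by (intro prod.cong) (auto simp: s[symmetric] indicator_def)
    finally show ?thesis by simp
  qed
  have int: "integrable M z" "expectation z = - (ln 2 / 2) * (\<Sum>k\<in>I. prob (A k \<union> B k))"
  proof -
    have i: "integrable M (\<lambda>x. - (ln 2 / 2) * indicator (A k \<union> B k) x :: real)" if "k \<in> I" for k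
      using AB that by (intro integrable_mult_right integrable_real_indicator) (auto simp: emeasure_eq_measure)
    show "integrable M z" unfolding z_def by (intro Bochner_Integration.integrable_sum i)
    show "expectation z = - (ln 2 / 2) * (\<Sum>k\<in>I. prob (A k \<union> B k))"
      unfolding z_def sum_distrib_left
      by (subst Bochner_Integration.integral_sum[OF i]) (use AB in \<open>auto intro!: sum.cong\<close>)
  qed
  have "ennreal (2 powr - (\<Sum>k\<in>I. prob (A k \<union> B k))) = (ennreal (exp (expectation z)))\<^sup>2"
    unfolding int(2) by (simp add: ennreal_power powr_def flip: exp_double)
  also have "\<dots> \<le> (\<integral>\<^sup>+x. 1 * (\<Prod>k\<in>I. if x \<in> A k \<union> B k then ?s else 1) \<partial>M)\<^sup>2"
    unfolding expz using exp_expectation_le_nn_integral_exp[OF int(1)] by (simp add: power_mono)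
  also have "\<dots> \<le> (\<integral>\<^sup>+x. \<integral>\<^sup>+y. 1 * 1 * (\<Prod>k\<in>I. indicator (- bipartite_edges (A k) (B k)) (x, y)) \<partial>M \<partial>M)"
    by (rule square_nn_integral_le_nonedges) (use assms in auto)
  also have "\<dots> = (\<integral>\<^sup>+x. \<integral>\<^sup>+y. indicator (space (M \<Otimes>\<^sub>M M) - ?E) (x, y) \<partial>M \<partial>M)"
  proof (intro nn_integral_cong)
    fix x y assume "x \<in> space M" "y \<in> space M"
    then show "1 * 1 * (\<Prod>k\<in>I. indicator (- bipartite_edges (A k) (B k)) (x, y))
        = (indicator (space (M \<Otimes>\<^sub>M M) - ?E) (x, y) :: ennreal)"
      using assms(1) by (auto simp: indicator_def space_pair_measure prod_zero_iff)
  qed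
  also have "\<dots> = emeasure (M \<Otimes>\<^sub>M M) (space (M \<Otimes>\<^sub>M M) - ?E)"
    using E by (subst emeasure_pair_measure) auto
  also have "\<dots> = ennreal (1 - measure (M \<Otimes>\<^sub>M M) ?E)"
    using P.P.prob_compl[OF E] by (simp add: P.P.emeasure_eq_measure)
  finally show ?thesis
    by (subst (asm) ennreal_le_iff) (auto simp: P.P.prob_le_1)
qed

text \<open>Finite truncations of the edge set increase to the whole, and one \<open>S\<close>
  bounds all their sums, so the finite estimate passes to the limit.\<close>

lemma (in prob_space) powr_bound_le_prob_nonedges:
  fixes A B :: "nat \<Rightarrow> 'a set"
  assumes AB: "\<And>k. k \<in> I \<Longrightarrow> A k \<in> sets M" "\<And>k. k \<in> I \<Longrightarrow> B k \<in> sets M"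
      "\<And>k. k \<in> I \<Longrightarrow> A k \<inter> B k = {}"
    and S: "\<And>J. finite J \<Longrightarrow> J \<subseteq> I \<Longrightarrow> (\<Sum>k\<in>J. prob (A k \<union> B k)) \<le> S"
  shows "2 powr - S \<le> 1 - measure (M \<Otimes>\<^sub>M M) (\<Union>k\<in>I. bipartite_edges (A k) (B k))"
proof -
  interpret P: pair_prob_space M M ..
  define F where "F n = (\<Union>k\<in>I \<inter> {..n}. bipartite_edges (A k) (B k))" for n
  have F_sets: "range F \<subseteq> sets (M \<Otimes>\<^sub>M M)"
    unfolding F_def using AB by (auto intro!: sets.finite_UN sets_bipartite_edges)
  have "incseq F" unfolding F_def by (force simp: incseq_def)
  then have lim: "(\<lambda>n. measure (M \<Otimes>\<^sub>M M) (F n)) \<longlonglongrightarrow> measure (M \<Otimes>\<^sub>M M) (\<Union>n. F n)"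
    using P.P.finite_Lim_measure_incseq[OF F_sets] by simp
  have "2 powr - S \<le> 1 - measure (M \<Otimes>\<^sub>M M) (F n)" for n
  proof -
    have "2 powr - S \<le> 2 powr - (\<Sum>k\<in>I \<inter> {..n}. prob (A k \<union> B k))"
      using S[of "I \<inter> {..n}"] by simp
    also have "\<dots> \<le> 1 - measure (M \<Otimes>\<^sub>M M) (F n)"
      unfolding F_def by (rule powr_sum_prob_le_prob_nonedges) (use AB in auto)
    finally show ?thesis .
  qed
  then have "measure (M \<Otimes>\<^sub>M M) (\<Union>n. F n) \<le> 1 - 2 powr - S"
    by (intro LIMSEQ_le_const2[OF lim]) (auto simp: algebra_simps intro: exI[of _ 0])
  moreover have "(\<Union>n. F n) = (\<Union>k\<in>I. bipartite_edges (A k) (B k))"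
    unfolding F_def by auto
  ultimately show ?thesis by simp
qed

section \<open>From Lebesgue measurable sets to disjoint Borel sets\<close>

text \<open>The probabilistic bound needs genuinely disjoint sets that are measurable without
  completion. Discarding a null set of points from the sides costs only null strips in the plane,
  and shrinking the sides can only lower the sum to be bounded.\<close>

lemma bipartite_wrt_borel_core:
  assumes "bipartite_wrt W A B"
  obtains A' B' where "A' \<in> sets borel" "B' \<in> sets borel" "A' \<subseteq> A" "B' \<subseteq> B" "A' \<inter> B' = {}"
    "AE p in lebesgue. p \<in> unit_square \<longrightarrow> p \<notin> bipartite_edges A' B' \<longrightarrow> W p = 0"
proof -
  have A: "A \<in> sets lebesgue" and B: "B \<in> sets lebesgue" and null: "A \<inter> B \<in> null_sets lebesgue"
    and supp: "graphon_support W - (A \<times> B \<union> B \<times> A) \<in> null_sets lebesgue"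
    using assms by (auto simp: bipartite_wrt_def)
  obtain S1 N1 N1' where 1: "A = S1 \<union> N1" "N1 \<subseteq> N1'" "N1' \<in> null_sets lborel" "S1 \<in> sets lborel"
    using A by (rule sets_completionE)
  obtain S2 N2 N2' where 2: "B = S2 \<union> N2" "N2 \<subseteq> N2'" "N2' \<in> null_sets lborel" "S2 \<in> sets lborel"
    using B by (rule sets_completionE)
  obtain N3 where 3: "A \<inter> B \<subseteq> N3" "N3 \<in> null_sets lborel"
    using null by (auto simp: null_sets_completion_iff2)
  \<comment> \<open>The first two sets cover what the Borel parts miss; \<open>N3\<close> covers
    what is lost by subtracting \<open>S1\<close> from \<open>S2\<close>.\<close>
  define N where "N = N1' \<union> N2' \<union> N3"
  have N: "N \<in> null_sets lborel" unfolding N_def using 1 2 3 by auto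
  then have "N \<times> UNIV \<union> UNIV \<times> N \<in> null_sets (lborel \<Otimes>\<^sub>M lborel :: (real \<times> real) measure)"
    by (intro null_sets.Un lborel.times_in_null_sets1 lborel.times_in_null_sets2) auto
  then have "N \<times> UNIV \<union> UNIV \<times> N \<in> null_sets lebesgue"
    by (simp add: lborel_prod null_sets_completionI)
  then have bad: "(graphon_support W - (A \<times> B \<union> B \<times> A)) \<union> (N \<times> UNIV \<union> UNIV \<times> N) \<in> null_sets lebesgue"
    using supp by blast
  have "AE p in lebesgue. p \<in> unit_square \<longrightarrow> p \<notin> bipartite_edges S1 (S2 - S1) \<longrightarrow> W p = 0"
  proof (rule AE_I'[OF bad])
    show "{p \<in> space lebesgue. \<not> (p \<in> unit_square \<longrightarrow> p \<notin> bipartite_edges S1 (S2 - S1) \<longrightarrow> W p = 0)}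
      \<subseteq> (graphon_support W - (A \<times> B \<union> B \<times> A)) \<union> (N \<times> UNIV \<union> UNIV \<times> N)"
      using 1 2 3 unfolding N_def graphon_support_def bipartite_edges_def by blast
  qed
  then show ?thesis
    using 1 2 by (intro that[of S1 "S2 - S1"]) auto
qed

text \<open>Links the product probability measure with planar Lebesgue measure, in which fullness is
  stated. Measurability in the product space forces \<open>E\<close> into
  \<open>X \<times> X\<close>, so the restricting indicators in the iterated integral change
  nothing.\<close>

lemma emeasure_pair_restrict_lborel:
  fixes X :: "real set" and E :: "(real \<times> real) set"
  assumes X: "X \<in> sets borel" and E: "E \<in> sets (restrict_space lborel X \<Otimes>\<^sub>M restrict_space lborel X)"
    and E': "E \<in> sets borel"
  shows "emeasure (restrict_space lborel X \<Otimes>\<^sub>M restrict_space lborel X) E = emeasure lborel E"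
proof -
  interpret R: sigma_finite_measure "restrict_space lborel X"
    using X by (intro sigma_finite_measure_restrict_space lborel.sigma_finite_measure_axioms) auto
  have sub: "E \<subseteq> X \<times> X"
    using sets.sets_into_space[OF E] by (simp add: space_pair_measure space_restrict_space)
  have "emeasure (restrict_space lborel X \<Otimes>\<^sub>M restrict_space lborel X) E
      = (\<integral>\<^sup>+x. (\<integral>\<^sup>+y. indicator E (x, y) * indicator X y \<partial>lborel) * indicator X x \<partial>lborel)"
    using X by (simp add: R.emeasure_pair_measure[OF E] nn_integral_restrict_space)
  also have "\<dots> = (\<integral>\<^sup>+x. \<integral>\<^sup>+y. indicator E (x, y) \<partial>lborel \<partial>lborel)"
  proof (rule nn_integral_cong)
    fix x
    have "(\<integral>\<^sup>+y. indicator E (x, y) * indicator X y \<partial>lborel) = (\<integral>\<^sup>+y. indicator E (x, y) \<partial>lborel :: ennreal)"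
      using sub by (intro nn_integral_cong) (auto simp: indicator_def)
    moreover have "(\<integral>\<^sup>+y. indicator E (x, y) \<partial>lborel :: ennreal) = 0" if "x \<notin> X"
    proof -
      have "indicator E (x, y) = (0 :: ennreal)" for y
        using sub that by (auto simp: indicator_def)
      then show ?thesis by simp
    qed
    ultimately show "(\<integral>\<^sup>+y. indicator E (x, y) * indicator X y \<partial>lborel) * indicator X x
        = (\<integral>\<^sup>+y. indicator E (x, y) \<partial>lborel :: ennreal)"
      by (cases "x \<in> X") auto
  qed
  also have "\<dots> = emeasure (lborel \<Otimes>\<^sub>M lborel) E"
    by (rule lborel.emeasure_pair_measure[symmetric], subst lborel_prod) (simp add: E')
  finally show ?thesis by (simp add: lborel_prod)
qed

section \<open>The bound for separating systems\<close>

theorem theorem1p7: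
  fixes \<epsilon> :: real and N :: enat
    and W :: "nat \<Rightarrow> real \<times> real \<Rightarrow> real" and A B :: "nat \<Rightarrow> real set"
  assumes "0 < \<epsilon>" and "\<epsilon> \<le> 1"
    and "separating_system N W"
    and "full (1 - \<epsilon>) N W"
    and "\<And>k. k \<in> indices N \<Longrightarrow> bipartite_wrt (W k) (A k) (B k)"
  shows "(\<Sum>\<^sub>\<infinity>k\<in>indices N. emeasure lebesgue (A k \<union> B k)) \<ge> ennreal (log 2 (1 / \<epsilon>))"
proof (cases "(\<Sum>\<^sub>\<infinity>k\<in>indices N. emeasure lebesgue (A k \<union> B k))")
  case top
  then show ?thesis by simp
next
  case (real S)
  let ?I = "indices N" and ?M = "restrict_space lborel {0..1::real}"
  define core where "core k A' B' \<longleftrightarrow>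
    A' \<in> sets borel \<and> B' \<in> sets borel \<and> A' \<subseteq> A k \<and> B' \<subseteq> B k \<and> A' \<inter> B' = {} \<and>
    (AE p in lebesgue. p \<in> unit_square \<longrightarrow> p \<notin> bipartite_edges A' B' \<longrightarrow> W k p = 0)" for k A' B'
  have "\<exists>A' B'. core k A' B'" if k: "k \<in> ?I" for k
  proof -
    obtain A' B' where "A' \<in> sets borel" "B' \<in> sets borel" "A' \<subseteq> A k" "B' \<subseteq> B k" "A' \<inter> B' = {}"
      "AE p in lebesgue. p \<in> unit_square \<longrightarrow> p \<notin> bipartite_edges A' B' \<longrightarrow> W k p = 0"
      using assms(5)[OF k] by (rule bipartite_wrt_borel_core)
    then have "core k A' B'" unfolding core_def by (intro conjI)
    then show ?thesis by blast
  qed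
  then obtain A' B' where core: "\<And>k. k \<in> ?I \<Longrightarrow> core k (A' k) (B' k)"
    by metis
  have borel: "A' k \<in> sets borel" "B' k \<in> sets borel"
    and sub: "A' k \<subseteq> A k" "B' k \<subseteq> B k"
    and disj: "A' k \<inter> B' k = {}"
    and AE: "AE p in lebesgue. p \<in> unit_square \<longrightarrow> p \<notin> bipartite_edges (A' k) (B' k) \<longrightarrow> W k p = 0"
    if "k \<in> ?I" for k
    using core[OF that] unfolding core_def by simp_all
  have AB: "A k \<subseteq> {0..1}" "B k \<subseteq> {0..1}" "A k \<union> B k \<in> sets lebesgue" if "k \<in> ?I" for k
    using assms(5)[OF that] by (auto simp: bipartite_wrt_def)
  interpret M: prob_space ?M
    by (rule prob_space_restrict_space) auto
  interpret P: pair_prob_space ?M ?M ..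
  define E where "E = (\<Union>k\<in>?I. bipartite_edges (A' k) (B' k))"
  have sets_M: "A' k \<in> sets ?M" "B' k \<in> sets ?M" if "k \<in> ?I" for k
    using borel[OF that] order_trans[OF sub(1) AB(1)] order_trans[OF sub(2) AB(2)] that
    by (simp_all add: sets_restrict_space_iff)
  have E_M: "E \<in> sets (?M \<Otimes>\<^sub>M ?M)"
    unfolding E_def by (intro sets.countable_UN'' sets_bipartite_edges sets_M) auto
  have E_borel: "E \<in> sets borel"
    unfolding E_def
  proof (intro sets.countable_UN'')
    fix k assume "k \<in> ?I"
    then have "bipartite_edges (A' k) (B' k) \<in> sets (lborel \<Otimes>\<^sub>M lborel)"
      using borel by (intro sets_bipartite_edges) auto
    then show "bipartite_edges (A' k) (B' k) \<in> sets borel" unfolding lborel_prod by simp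
  qed auto
  have "2 powr - S \<le> 1 - measure (?M \<Otimes>\<^sub>M ?M) E"
    unfolding E_def
  proof (rule M.powr_bound_le_prob_nonedges[OF sets_M disj])
    fix J assume J: "finite J" "J \<subseteq> ?I"
    \<comment> \<open>Borel cores are no larger than the original sides, and finite partial sums
      stay below the infinite sum \<open>S\<close>.\<close>
    have "ennreal (\<Sum>k\<in>J. M.prob (A' k \<union> B' k)) = (\<Sum>k\<in>J. emeasure ?M (A' k \<union> B' k))"
      by (simp add: M.emeasure_eq_measure flip: sum_ennreal)
    also have "\<dots> \<le> (\<Sum>k\<in>J. emeasure lebesgue (A k \<union> B k))"
    proof (rule sum_mono)
      fix k assume "k \<in> J"
      then have k: "k \<in> ?I" using J by auto
      then have "emeasure ?M (A' k \<union> B' k) = emeasure lborel (A' k \<union> B' k)"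
        using sub[OF k] AB[OF k] by (intro emeasure_restrict_space) auto
      also have "\<dots> = emeasure lebesgue (A' k \<union> B' k)"
        using borel k by simp
      also have "\<dots> \<le> emeasure lebesgue (A k \<union> B k)"
        using sub[OF k] AB[OF k] by (intro emeasure_mono) auto
      finally show "emeasure ?M (A' k \<union> B' k) \<le> emeasure lebesgue (A k \<union> B k)" .
    qed
    also have "\<dots> = (\<Sum>\<^sub>\<infinity>k\<in>J. emeasure lebesgue (A k \<union> B k))"
      using J by simp
    also have "\<dots> \<le> (\<Sum>\<^sub>\<infinity>k\<in>?I. emeasure lebesgue (A k \<union> B k))"
      using J by (intro infsum_mono_neutral nonneg_summable_on_complete) auto
    finally show "(\<Sum>k\<in>J. M.prob (A' k \<union> B' k)) \<le> S"
      using real by (simp add: ennreal_le_iff)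
  qed
  \<comment> \<open>Fullness forces \<open>E\<close> to be large: the truncated sum is at most 1 on
    \<open>E\<close> and vanishes almost everywhere on the rest of the square.\<close>
  moreover have "1 - \<epsilon> \<le> measure (?M \<Otimes>\<^sub>M ?M) E"
  proof -
    have "ennreal (1 - \<epsilon>) \<le> (\<integral>\<^sup>+p\<in>unit_square. system_sum N W p \<partial>lebesgue)"
      using assms(4) by (simp add: full_def)
    also have "\<dots> \<le> (\<integral>\<^sup>+p. indicator E p \<partial>lebesgue)"
    proof (rule nn_integral_mono_AE)
      \<comment> \<open>Countability of the indices merges the exceptional null sets into
        one.\<close>
      have "AE p in lebesgue. \<forall>k\<in>?I. p \<in> unit_square \<longrightarrow> p \<notin> bipartite_edges (A' k) (B' k) \<longrightarrow> W k p = 0"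
        using AE by (subst AE_ball_countable) auto
      then show "AE p in lebesgue. system_sum N W p * indicator unit_square p \<le> indicator E p"
      proof eventually_elim
        case (elim p)
        show ?case
        proof (cases "p \<in> unit_square \<and> p \<notin> E")
          case True
          then have "(\<Sum>\<^sub>\<infinity>k\<in>?I. ennreal (W k p)) = 0"
            using elim by (intro infsum_0) (auto simp: E_def)
          then show ?thesis by (simp add: system_sum_def)
        next
          case False
          then show ?thesis by (auto simp: system_sum_def indicator_def)
        qed
      qed
    qed
    also have "\<dots> = emeasure lborel E"
      using E_borel by simp
    also have "\<dots> = emeasure (?M \<Otimes>\<^sub>M ?M) E"
      using E_M E_borel by (simp add: emeasure_pair_restrict_lborel)
    finally show ?thesis
      by (simp add: P.P.emeasure_eq_measure)
  qed
  ultimately have "2 powr - S \<le> \<epsilon>" by simp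
  then have "log 2 (1 / \<epsilon>) \<le> S"
    using assms(1) by (simp add: log_divide powr_le_iff)
  then show ?thesis
    using real by (simp add: ennreal_leI)
qed

end
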